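(* Let $X$ be an infinite locally compact Hausdorff space, let $\theta:U\to V$ be a minimal partial automorphism on $X$, and let $Y\subset U$ be a closed subset of $X$. Then the following are equivalent: (1) The restricted partial automorphism $\theta^{(U\setminus Y)}$ is minimal. (2) Taking out $Y$ preserves dense orbits. (3) Taking out $Y$ preserves orbit size, and $\operatorname{Orb}_+(y)$ as well as $\operatorname{Orb}_-(y)$ are dense in $X$ for every $y\in Y$. If $X$ is compact, then (1), (2) and (3) are furthermore equivalent to each of: (4) Taking out $Y$ preserves orbit size. (5) The set $Y$ is contained in $D_{\mathrm{gl}}$ and meets every $\theta$-orbit at most once. (6) $M^1_{\theta^{(U\setminus Y)}}(X)=M^1_\theta(X)$.
   Context: A partial automorphism on $X$ is a homeomorphism $\theta:U\to V$ between open subsets $U,V$ of $X$. For $n\in\mathbb{Z}$, $D_{-n}$ denotes the maximal domain of $\theta^n$ (so $D_0=X$, $D_{-1}=U$, $D_1=V$), and $D_{\mathrm{gl}}=\bigcap_{n\in\mathbb{Z}}D_n$. The orbit of $x$ is $\operatorname{Orb}(x)=\{\theta^n(x):n\in\mathbb{Z},\ x\in D_{-n}\}$; the forward orbit $\operatorname{Orb}_+(x)$ and backward orbit $\operatorname{Orb}_-(x)$ are obtained by restricting to $n\geq0$ and $n\leq0$, respectively. A subset $Z\subset X$ is $\theta$-invariant if $\theta(Z\cap U)\subset Z$ and $\theta^{-1}(Z\cap V)\subset Z$; $\theta$ is minimal if the only closed $\theta$-invariant subsets are $\emptyset$ and $X$. $M^1_\theta(X)$ is the set of regular Borel probability measures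 $\mu$ on $X$ with $\mu(\theta^{-1}(B))=\mu(B)$ for all measurable $B\subset V$. For an open set $W\subset U$, $\theta^{(W)}:W\to\theta(W)$ is the partial automorphism on $X$ with $\theta^{(W)}(x)=\theta(x)$ for $x\in W$; its orbits are denoted $\operatorname{Orb}^{W}(x)$. Taking out $Y$ preserves orbit size if $|\operatorname{Orb}^{U\setminus Y}(x)|=|\operatorname{Orb}(x)|$ for all $x\in X$. Taking out $Y$ preserves dense orbits if whenever $\operatorname{Orb}(x)$ is dense in $X$, so is $\operatorname{Orb}^{U\setminus Y}(x)$. $Y$ meets every $\theta$-orbit at most once if $\{\theta^n(y)\}\cap Y\subset\{y\}$ for all $n\in\mathbb{Z}\setminus\{0\}$ and $y\in Y\cap D_{-n}$. *)

theory Defs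
  imports "HOL-Probability.Probability" "HOL-Library.Equipollence"
begin

text \<open>
  The space \<open>X\<close> is the universe of a type of class \<^class>\<open>t2_space\<close>.  A partial automorphism
  \<open>\<theta> : U \<rightarrow> V\<close> is given by its domain \<open>U\<close> and a total function \<open>\<theta>\<close> whose values outside \<open>U\<close> are
  never used; its range is \<open>\<theta> ` U\<close> and its inverse is \<open>inv_into U \<theta>\<close>.  Hence, for \<open>W \<subseteq> U\<close>, the
  restriction \<open>\<theta>\<^sup>(\<^sup>W\<^sup>) : W \<rightarrow> \<theta>(W)\<close> is given by the pair \<open>W\<close>, \<open>\<theta>\<close>.
\<close>

definition partial_automorphism ::
    "'a::topological_space set \<Rightarrow> 'a set \<Rightarrow> ('a \<Rightarrow> 'a) \<Rightarrow> bool" where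
  "partial_automorphism U V \<theta> \<longleftrightarrow>
     open U \<and> open V \<and> homeomorphism U V \<theta> (inv_into U \<theta>)"

primrec nat_iter_dom :: "'a set \<Rightarrow> ('a \<Rightarrow> 'a) \<Rightarrow> nat \<Rightarrow> 'a set" where
  "nat_iter_dom U f 0 = UNIV"
| "nat_iter_dom U f (Suc n) = {x \<in> U. f x \<in> nat_iter_dom U f n}"

definition pa_power :: "'a set \<Rightarrow> ('a \<Rightarrow> 'a) \<Rightarrow> int \<Rightarrow> 'a \<Rightarrow> 'a" where
  "pa_power U \<theta> n =
     (if n \<ge> 0 then \<theta> ^^ nat n else inv_into U \<theta> ^^ nat (- n))"

text \<open>The set \<open>D\<^sub>n\<close>, which is the maximal domain of the power with exponent \<open>- n\<close> (not \<open>n\<close>).\<close>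

definition pa_D :: "'a set \<Rightarrow> ('a \<Rightarrow> 'a) \<Rightarrow> int \<Rightarrow> 'a set" where
  "pa_D U \<theta> n =
     (if n \<le> 0 then nat_iter_dom U \<theta> (nat (- n))
      else nat_iter_dom (\<theta> ` U) (inv_into U \<theta>) (nat n))"

definition pa_D_gl :: "'a set \<Rightarrow> ('a \<Rightarrow> 'a) \<Rightarrow> 'a set" where
  "pa_D_gl U \<theta> = (\<Inter>n. pa_D U \<theta> n)"

definition pa_orbit :: "'a set \<Rightarrow> ('a \<Rightarrow> 'a) \<Rightarrow> 'a \<Rightarrow> 'a set" where
  "pa_orbit U \<theta> x = {pa_power U \<theta> n x | n. x \<in> pa_D U \<theta> (- n)}"

definition pa_forward_orbit :: "'a set \<Rightarrow> ('a \<Rightarrow> 'a) \<Rightarrow> 'a \<Rightarrow> 'a set" where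
  "pa_forward_orbit U \<theta> x = {pa_power U \<theta> n x | n. n \<ge> 0 \<and> x \<in> pa_D U \<theta> (- n)}"

definition pa_backward_orbit :: "'a set \<Rightarrow> ('a \<Rightarrow> 'a) \<Rightarrow> 'a \<Rightarrow> 'a set" where
  "pa_backward_orbit U \<theta> x = {pa_power U \<theta> n x | n. n \<le> 0 \<and> x \<in> pa_D U \<theta> (- n)}"

definition pa_invariant :: "'a set \<Rightarrow> ('a \<Rightarrow> 'a) \<Rightarrow> 'a set \<Rightarrow> bool" where
  "pa_invariant U \<theta> Z \<longleftrightarrow>
     \<theta> ` (Z \<inter> U) \<subseteq> Z \<and> inv_into U \<theta> ` (Z \<inter> \<theta> ` U) \<subseteq> Z"

definition pa_minimal :: "'a::topological_space set \<Rightarrow> ('a \<Rightarrow> 'a) \<Rightarrow> bool" where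
  "pa_minimal U \<theta> \<longleftrightarrow>
     (\<forall>Z. closed Z \<and> pa_invariant U \<theta> Z \<longrightarrow> Z = {} \<or> Z = UNIV)"

definition preserves_orbit_size :: "'a set \<Rightarrow> ('a \<Rightarrow> 'a) \<Rightarrow> 'a set \<Rightarrow> bool" where
  "preserves_orbit_size U \<theta> Y \<longleftrightarrow>
     (\<forall>x. pa_orbit (U - Y) \<theta> x \<approx> pa_orbit U \<theta> x)"

definition preserves_dense_orbits ::
    "'a::topological_space set \<Rightarrow> ('a \<Rightarrow> 'a) \<Rightarrow> 'a set \<Rightarrow> bool" where
  "preserves_dense_orbits U \<theta> Y \<longleftrightarrow>
     (\<forall>x. closure (pa_orbit U \<theta> x) = UNIV \<longrightarrow> closure (pa_orbit (U - Y) \<theta> x) = UNIV)"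

definition meets_orbits_at_most_once :: "'a set \<Rightarrow> ('a \<Rightarrow> 'a) \<Rightarrow> 'a set \<Rightarrow> bool" where
  "meets_orbits_at_most_once U \<theta> Y \<longleftrightarrow>
     (\<forall>n. n \<noteq> 0 \<longrightarrow> (\<forall>y \<in> Y \<inter> pa_D U \<theta> (- n). {pa_power U \<theta> n y} \<inter> Y \<subseteq> {y}))"

text \<open>
  Regularity is outer regularity by open sets and inner regularity by compact sets, on all Borel
  sets.  It is part of the definition below because \<open>X\<close> need not be metrizable.
\<close>

definition regular_borel_measure :: "'a::topological_space measure \<Rightarrow> bool" where
  "regular_borel_measure \<mu> \<longleftrightarrow> sets \<mu> = sets borel \<and>
     (\<forall>B \<in> sets borel.
        emeasure \<mu> B = (INF G \<in> {G. B \<subseteq> G \<and> open G}. emeasure \<mu> G) \<and>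
        emeasure \<mu> B = (SUP K \<in> {K. K \<subseteq> B \<and> compact K}. emeasure \<mu> K))"

definition invariant_prob_measures ::
    "'a::topological_space set \<Rightarrow> ('a \<Rightarrow> 'a) \<Rightarrow> 'a measure set" where
  "invariant_prob_measures U \<theta> =
     {\<mu>. prob_space \<mu> \<and> regular_borel_measure \<mu> \<and>
         (\<forall>B \<in> sets borel. B \<subseteq> \<theta> ` U \<longrightarrow> emeasure \<mu> (\<theta> -` B \<inter> U) = emeasure \<mu> B)}"

end

theory Submission
  imports Defs
begin

text \<open>
  Closures of invariant sets are invariant, so a partial automorphism is minimal exactly when all
  its orbits are dense; hence the restriction is minimal exactly when dense orbits are preserved.
  On an infinite Hausdorff space a dense orbit is infinite, and all orbits are countable, so orbit
  size is preserved exactly when every orbit of the restriction to \<open>U - Y\<close> is infinite.  This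
  restriction is called the cut map here, and its orbits are the cut orbits.

  The central condition is \<open>cut_ends_free\<close>: going backward from a point of \<open>Y\<close>, and going forward
  from a point of \<open>\<theta>(Y)\<close>, one never stops and never meets the cut again.  It is necessary for
  infinite cut orbits because a point of \<open>Y\<close> has no forward step left after the cut, and a point
  of \<open>\<theta>(Y)\<close> no backward step.  It is sufficient because a finite cut orbit cannot be invariant
  under \<open>\<theta>\<close>, which is minimal; hence it has a point at the cut, and from there infinitely many
  distinct points: a repetition would produce a finite \<open>\<theta>\<close>-invariant set.
  Since \<open>\<theta>\<close> has no periodic points, the condition says precisely that \<open>Y\<close> lies in the domain of all
  powers and meets every orbit at most once.

  If moreover the forward and backward orbits of the points of \<open>Y\<close> are dense, then a nonempty closed
  set \<open>C\<close> invariant under the cut map is everything: either \<open>C\<close> is \<open>\<theta>\<close>-invariant, or \<open>\<theta>\<close> or its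
  inverse leads out of \<open>C\<close> across the cut, and \<open>C\<close> contains one of these half orbits, up to one point
  that is recovered from invariance (\<open>bi_minimal_cutI\<close>).  So the cut map is minimal; conversely,
  if it is minimal, then these half orbits are dense because the cut orbits of \<open>y\<close> and \<open>\<theta>(y)\<close> lie
  inside them.  On a compact space infinite half orbits are automatically dense, since their
  accumulation points form a nonempty closed invariant set (\<open>dense_iterates_compact\<close>), so preserved
  orbit size suffices.

  A probability measure invariant under the cut map is \<open>\<theta>\<close>-invariant once \<open>Y\<close> and \<open>\<theta>(Y)\<close> are null
  sets.  Given \<open>cut_ends_free\<close>, the preimages of \<open>Y\<close> under iteration are infinitely many disjoint sets of
  equal measure, so \<open>Y\<close> is null, and likewise \<open>\<theta>(Y)\<close>.  Conversely, the uniform measure on a finite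
  cut orbit would be invariant under the cut map but not under \<open>\<theta>\<close>.
\<close>

section \<open>Iterates of partial maps\<close>

text \<open>
  A partial automorphism is treated below as a pair of mutually inverse maps \<open>f : U \<rightarrow> V\<close> and
  \<open>g : V \<rightarrow> U\<close>.  This description is symmetric under exchanging \<open>(U, f)\<close> with \<open>(V, g)\<close>, so each
  statement about forward iteration also yields the one about backward iteration, and the same
  inverse \<open>g\<close> serves all restrictions of \<open>f\<close>.
\<close>

definition iterates :: "'a set \<Rightarrow> ('a \<Rightarrow> 'a) \<Rightarrow> 'a \<Rightarrow> 'a set" where
  "iterates U f x = {(f ^^ n) x | n. x \<in> nat_iter_dom U f n}"

definition bi_orbit :: "'a set \<Rightarrow> 'a set \<Rightarrow> ('a \<Rightarrow> 'a) \<Rightarrow> ('a \<Rightarrow> 'a) \<Rightarrow> 'a \<Rightarrow> 'a set" where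
  "bi_orbit U V f g x = iterates U f x \<union> iterates V g x"

definition bi_invariant :: "'a set \<Rightarrow> 'a set \<Rightarrow> ('a \<Rightarrow> 'a) \<Rightarrow> ('a \<Rightarrow> 'a) \<Rightarrow> 'a set \<Rightarrow> bool" where
  "bi_invariant U V f g Z \<longleftrightarrow> f ` (Z \<inter> U) \<subseteq> Z \<and> g ` (Z \<inter> V) \<subseteq> Z"

definition bi_minimal ::
    "'a::topological_space set \<Rightarrow> 'a set \<Rightarrow> ('a \<Rightarrow> 'a) \<Rightarrow> ('a \<Rightarrow> 'a) \<Rightarrow> bool" where
  "bi_minimal U V f g \<longleftrightarrow>
     (\<forall>Z. closed Z \<and> bi_invariant U V f g Z \<longrightarrow> Z = {} \<or> Z = UNIV)"

lemma bi_minimal_swap: "bi_minimal U V f g \<longleftrightarrow> bi_minimal V U g f"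
  unfolding bi_minimal_def bi_invariant_def by blast

lemma bi_orbit_swap: "bi_orbit U V f g x = bi_orbit V U g f x"
  unfolding bi_orbit_def by (rule Un_commute)

lemma nat_iter_dom_iff: "x \<in> nat_iter_dom U f n \<longleftrightarrow> (\<forall>k<n. (f ^^ k) x \<in> U)"
proof (induction n arbitrary: x)
  case 0
  then show ?case by simp
next
  case (Suc n)
  have "x \<in> nat_iter_dom U f (Suc n) \<longleftrightarrow> (f ^^ 0) x \<in> U \<and> (\<forall>k<n. (f ^^ Suc k) x \<in> U)"
    using Suc by (simp add: funpow_swap1)
  also have "\<dots> \<longleftrightarrow> (\<forall>k<Suc n. (f ^^ k) x \<in> U)"
    by (simp only: All_less_Suc2)
  finally show ?case .
qed

declare nat_iter_dom.simps [simp del]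

lemma iterates_total:
  assumes "\<And>k. (f ^^ k) x \<in> U"
  shows "iterates U f x = range (\<lambda>k. (f ^^ k) x)"
  using assms by (auto simp: iterates_def nat_iter_dom_iff)

lemma iterates_outside: "x \<notin> U \<Longrightarrow> iterates U f x = {x}"
proof -
  assume "x \<notin> U"
  then have "x \<in> nat_iter_dom U f n \<longleftrightarrow> n = 0" for n
    by (cases n) (auto simp: nat_iter_dom.simps)
  then show ?thesis by (auto simp: iterates_def)
qed

lemma infinite_iterates_total:
  assumes "infinite (iterates U f x)"
  shows "(f ^^ k) x \<in> U"
proof (rule ccontr)
  assume "(f ^^ k) x \<notin> U"
  then have "x \<in> nat_iter_dom U f n \<Longrightarrow> n \<le> k" for n
    by (metis nat_iter_dom_iff not_le)
  then have "iterates U f x \<subseteq> (\<lambda>n. (f ^^ n) x) ` {..k}"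
    by (auto simp: iterates_def)
  then show False
    using assms finite_subset by blast
qed

lemma iterates_mono: "U' \<subseteq> U \<Longrightarrow> iterates U' f x \<subseteq> iterates U f x"
  unfolding iterates_def nat_iter_dom_iff by blast

lemma self_in_iterates: "x \<in> iterates U f x"
  by (auto simp: iterates_def nat_iter_dom_iff intro!: exI[of _ 0])

lemma iterates_shift: "iterates U f (f x) \<subseteq> iterates U f x" if "x \<in> U"
proof
  fix z assume "z \<in> iterates U f (f x)"
  then obtain n where "z = (f ^^ n) (f x)" "f x \<in> nat_iter_dom U f n"
    by (auto simp: iterates_def)
  then have "z = (f ^^ Suc n) x" "x \<in> nat_iter_dom U f (Suc n)"
    using that by (auto simp: nat_iter_dom.simps funpow_swap1)
  then show "z \<in> iterates U f x"
    unfolding iterates_def by blast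
qed

lemma iterates_least:
  assumes "x \<in> Z" "f ` (Z \<inter> U) \<subseteq> Z"
  shows "iterates U f x \<subseteq> Z"
proof -
  have "x \<in> nat_iter_dom U f n \<Longrightarrow> (f ^^ n) x \<in> Z" for n
    by (induction n) (use assms in \<open>auto simp: nat_iter_dom_iff\<close>)
  then show ?thesis by (auto simp: iterates_def)
qed

lemma iterates_closed:
  assumes "z \<in> iterates U f x" "z \<in> U"
  shows "f z \<in> iterates U f x"
proof -
  obtain n where n: "z = (f ^^ n) x" "x \<in> nat_iter_dom U f n"
    using assms by (auto simp: iterates_def)
  then have "x \<in> nat_iter_dom U f (Suc n)" "f z = (f ^^ Suc n) x"
    using assms(2) by (auto simp: nat_iter_dom_iff less_Suc_eq)
  then show ?thesis unfolding iterates_def by blast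
qed

text \<open>Applying \<open>g\<close> undoes the last step of a chain of iterates of \<open>f\<close>.  Only the starting point
  has no last step, which is why the forward iterates alone need not be invariant under \<open>g\<close>.\<close>

lemma iterates_backward:
  assumes "homeomorphism U V f g" "z \<in> iterates U f x"
  shows "z = x \<or> g z \<in> iterates U f x"
proof -
  obtain n where n: "z = (f ^^ n) x" "x \<in> nat_iter_dom U f n"
    using assms by (auto simp: iterates_def)
  show ?thesis
  proof (cases n)
    case 0
    then show ?thesis using n by simp
  next
    case (Suc m)
    then have "(f ^^ m) x \<in> U" "x \<in> nat_iter_dom U f m"
      using n by (auto simp: nat_iter_dom_iff)
    moreover from this have "g z = (f ^^ m) x"
      using n Suc homeomorphism_apply1[OF assms(1)] by simp
    ultimately show ?thesis by (auto simp: iterates_def)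
  qed
qed

lemma bi_invariant_bi_orbit:
  assumes H: "homeomorphism U V f g"
  shows "bi_invariant U V f g (bi_orbit U V f g x)"
proof -
  have step: "f z \<in> bi_orbit U V f g x"
    if "homeomorphism U V f g" "z \<in> bi_orbit U V f g x" "z \<in> U" for U V f g and z :: 'a
    using iterates_closed[of z U f x] iterates_closed[of x U f x] self_in_iterates[of x U f]
      iterates_backward[OF homeomorphism_symD[OF that(1)], of z x] that
    by (auto simp: bi_orbit_def)
  show ?thesis
    using step[OF H] step[OF homeomorphism_symD[OF H]]
    by (auto simp: bi_invariant_def bi_orbit_def)
qed

lemma bi_orbit_least:
  assumes "bi_invariant U V f g Z" "x \<in> Z"
  shows "bi_orbit U V f g x \<subseteq> Z"
  using assms iterates_least[of x Z f U] iterates_least[of x Z g V]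
  by (auto simp: bi_orbit_def bi_invariant_def)

lemma bi_invariant_iterates:
  assumes "bi_invariant U V f g Z" "x \<in> Z"
  shows "iterates U f x \<subseteq> Z" "iterates V g x \<subseteq> Z"
  using bi_orbit_least[OF assms] by (auto simp: bi_orbit_def)

lemma self_in_bi_orbit: "x \<in> bi_orbit U V f g x"
  using self_in_iterates by (auto simp: bi_orbit_def)

lemma bi_orbit_nonempty: "bi_orbit U V f g x \<noteq> {}"
  using self_in_bi_orbit[of x U V f g] by auto

lemma countable_bi_orbit: "countable (bi_orbit U V f g x)"
proof -
  have "countable (iterates U f x)" for U f
    by (rule countable_subset[of _ "range (\<lambda>n. (f ^^ n) x)"]) (auto simp: iterates_def)
  then show ?thesis by (simp add: bi_orbit_def)
qed

text \<open>The extra \<open>m\<close> lets one cancel a common initial part of two iterates.\<close>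

lemma funpow_inverse:
  assumes "homeomorphism U V f g" "\<And>k. (f ^^ k) x \<in> U"
  shows "(g ^^ n) ((f ^^ (n + m)) x) = (f ^^ m) x"
proof (induction n)
  case (Suc n)
  have "(g ^^ Suc n) ((f ^^ (Suc n + m)) x) = (g ^^ n) (g (f ((f ^^ (n + m)) x)))"
    by (simp add: funpow_swap1)
  also have "\<dots> = (f ^^ m) x"
    using Suc homeomorphism_apply1[OF assms(1) assms(2)] by simp
  finally show ?case .
qed simp

lemma homeomorphism_remove:
  assumes H: "homeomorphism U V f g" and "Y \<subseteq> U"
  shows "homeomorphism (U - Y) (V - f ` Y) f g"
proof (rule homeomorphism_of_subsets[OF H])
  show "f ` (U - Y) = V - f ` Y"
    using homeomorphism_image1[OF H] homeomorphism_apply1[OF H] assms(2)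
    by (auto simp: image_iff) (metis subset_eq)
qed auto

section \<open>The two-sided description of partial automorphisms\<close>

lemma inv_into_homeomorphism:
  assumes "homeomorphism U V f g" "y \<in> V"
  shows "inv_into U f y = g y"
proof (rule inv_into_f_eq)
  show "inj_on f U"
    by (rule inj_on_inverseI[of U g f]) (rule homeomorphism_apply1[OF assms(1)])
  show "g y \<in> U" "f (g y) = y"
    using assms(2) homeomorphism_image2[OF assms(1)] homeomorphism_apply2[OF assms(1)] by auto
qed

lemma pa_invariant_iff:
  assumes H: "homeomorphism U V f g"
  shows "pa_invariant U f Z \<longleftrightarrow> bi_invariant U V f g Z"
  unfolding pa_invariant_def bi_invariant_def homeomorphism_image1[OF H]
  by (simp add: image_subset_iff inv_into_homeomorphism[OF H])

lemma pa_minimal_iff: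
  assumes "homeomorphism U V f g"
  shows "pa_minimal U f \<longleftrightarrow> bi_minimal U V f g"
  by (simp add: pa_minimal_def bi_minimal_def pa_invariant_iff[OF assms])

lemma funpow_inv_into:
  assumes H: "homeomorphism U V f g" and "\<forall>k<n. (g ^^ k) x \<in> V"
  shows "(inv_into U f ^^ n) x = (g ^^ n) x"
  using assms(2) by (induction n) (auto simp: inv_into_homeomorphism[OF H])

text \<open>The maps \<open>inv_into U f\<close> and \<open>g\<close> may differ outside \<open>V\<close>, but iteration never evaluates them
  there.\<close>

lemma nat_iter_dom_inv_into:
  assumes H: "homeomorphism U V f g"
  shows "nat_iter_dom (f ` U) (inv_into U f) n = nat_iter_dom V g n"
proof (induction n)
  case (Suc n)
  then show ?case
    using inv_into_homeomorphism[OF H]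
    unfolding nat_iter_dom.simps homeomorphism_image1[OF H] by auto
qed (simp add: nat_iter_dom.simps)

lemma pa_D_neg: "pa_D U f (- int n) = nat_iter_dom U f n"
  by (simp add: pa_D_def)

lemma pa_D_pos:
  assumes "homeomorphism U V f g"
  shows "pa_D U f (int n) = nat_iter_dom V g n"
  using nat_iter_dom_inv_into[OF assms]
  by (cases n) (simp_all add: pa_D_def nat_iter_dom.simps(1) del: of_nat_Suc)

lemma pa_power_neg:
  assumes "homeomorphism U V f g" "x \<in> nat_iter_dom V g n"
  shows "pa_power U f (- int n) x = (g ^^ n) x"
  using funpow_inv_into[OF assms(1) assms(2)[unfolded nat_iter_dom_iff]]
  by (cases n) (simp_all add: pa_power_def del: of_nat_Suc funpow.simps)

lemma pa_forward_orbit_eq: "pa_forward_orbit U f x = iterates U f x"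
proof -
  have ex: "(\<exists>n\<ge>0. P n) \<longleftrightarrow> (\<exists>k. P (int k))" for P
    by (metis nonneg_int_cases of_nat_0_le_iff)
  have "z \<in> pa_forward_orbit U f x \<longleftrightarrow>
      (\<exists>n\<ge>0. z = pa_power U f n x \<and> x \<in> pa_D U f (- n))" for z
    unfolding pa_forward_orbit_def by blast
  then show ?thesis
    unfolding ex pa_D_neg by (auto simp: iterates_def pa_power_def)
qed

lemma pa_backward_orbit_eq:
  assumes H: "homeomorphism U V f g"
  shows "pa_backward_orbit U f x = iterates V g x"
proof -
  have ex: "(\<exists>n\<le>0. P n) \<longleftrightarrow> (\<exists>k. P (- int k))" for P
    by (metis neg_le_0_iff_le nonpos_int_cases of_nat_0_le_iff)
  have "z \<in> pa_backward_orbit U f x \<longleftrightarrow>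
      (\<exists>n\<le>0. z = pa_power U f n x \<and> x \<in> pa_D U f (- n))" for z
    unfolding pa_backward_orbit_def by blast
  then have "z \<in> pa_backward_orbit U f x \<longleftrightarrow>
      (\<exists>k. z = (g ^^ k) x \<and> x \<in> nat_iter_dom V g k)" for z
    unfolding ex minus_minus pa_D_pos[OF H] using pa_power_neg[OF H] by metis
  then show ?thesis
    by (auto simp: iterates_def)
qed

lemma pa_orbit_eq:
  assumes H: "homeomorphism U V f g"
  shows "pa_orbit U f x = bi_orbit U V f g x"
proof -
  have "pa_orbit U f x = pa_forward_orbit U f x \<union> pa_backward_orbit U f x"
    unfolding pa_orbit_def pa_forward_orbit_def pa_backward_orbit_def
    using linear by blast
  then show ?thesis
    by (simp add: pa_forward_orbit_eq pa_backward_orbit_eq[OF H] bi_orbit_def)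
qed

lemma pa_D_gl_iff:
  assumes H: "homeomorphism U V f g"
  shows "x \<in> pa_D_gl U f \<longleftrightarrow> (\<forall>k. (f ^^ k) x \<in> U \<and> (g ^^ k) x \<in> V)"
proof -
  have "x \<in> pa_D_gl U f \<longleftrightarrow> (\<forall>n. x \<in> pa_D U f (int n) \<and> x \<in> pa_D U f (- int n))"
    unfolding pa_D_gl_def INT_iff by (metis UNIV_I int_cases2)
  then show ?thesis
    by (auto simp: pa_D_neg pa_D_pos[OF H] nat_iter_dom_iff)
qed

section \<open>Minimality and orbits\<close>

lemma image_closure_open:
  assumes "open U" "continuous_on U f" "z \<in> closure A" "z \<in> U"
  shows "f z \<in> closure (f ` (A \<inter> U))"
proof -
  have "z \<in> closure (A \<inter> U)"
    using open_Int_closure_subset[OF assms(1), of A] assms by (auto simp: Int_commute)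
  show ?thesis
    unfolding closure_iff_nhds_not_empty
  proof (intro allI impI)
    fix A' S assume S: "S \<subseteq> A'" "open S" "f z \<in> S"
    have "open (U \<inter> f -` S)"
      using continuous_on_open_vimage[OF assms(1)] assms(2) S
      by (metis Int_commute)
    moreover have "z \<in> U \<inter> f -` S" using S assms by auto
    ultimately have "(A \<inter> U) \<inter> (U \<inter> f -` S) \<noteq> {}"
      using \<open>z \<in> closure (A \<inter> U)\<close> by (meson closure_iff_nhds_not_empty order_refl)
    then show "f ` (A \<inter> U) \<inter> A' \<noteq> {}" using S by blast
  qed
qed

lemma bi_invariant_closure:
  assumes "homeomorphism U V f g" "open U" "open V" "bi_invariant U V f g Z"
  shows "bi_invariant U V f g (closure Z)"
proof -
  have "f ` (closure Z \<inter> U) \<subseteq> closure Z"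
    if "open U" "continuous_on U f" "f ` (Z \<inter> U) \<subseteq> Z" for U f
    using image_closure_open[OF that(1,2)] closure_mono[OF that(3)] by blast
  then show ?thesis
    using assms by (auto simp: bi_invariant_def homeomorphism_def)
qed

text \<open>An orbit is the smallest invariant set through a point, so its closure is the smallest closed
  invariant set through that point.\<close>

lemma bi_minimal_iff_dense_orbits:
  assumes "homeomorphism U V f g" "open U" "open V"
  shows "bi_minimal U V f g \<longleftrightarrow> (\<forall>x. closure (bi_orbit U V f g x) = UNIV)"
proof
  assume "bi_minimal U V f g"
  then show "\<forall>x. closure (bi_orbit U V f g x) = UNIV"
    using bi_invariant_closure[OF assms bi_invariant_bi_orbit[OF assms(1)]] self_in_bi_orbit
    unfolding bi_minimal_def by (metis closed_closure closure_eq_empty empty_iff)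
next
  assume "\<forall>x. closure (bi_orbit U V f g x) = UNIV"
  then show "bi_minimal U V f g"
    unfolding bi_minimal_def using bi_orbit_least closure_minimal
    by (metis top.extremum_unique ex_in_conv)
qed

lemma finite_bi_invariant_empty:
  fixes Z :: "'a::t1_space set"
  assumes "bi_minimal U V f g" "infinite (UNIV :: 'a set)" "finite Z" "bi_invariant U V f g Z"
  shows "Z = {}"
  using assms finite_imp_closed unfolding bi_minimal_def by blast

lemma infinite_dense:
  fixes Z :: "'a::t1_space set"
  assumes "infinite (UNIV :: 'a set)" "closure Z = UNIV"
  shows "infinite Z"
  using assms finite_imp_closed closure_closed by metis

text \<open>A coincidence between two iterates would, by injectivity, make the point periodic, and
  a periodic orbit is a finite closed invariant set.\<close>

lemma inj_iterates:
  fixes f g :: "'a::t1_space \<Rightarrow> 'a"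
  assumes H: "homeomorphism U V f g" and min: "bi_minimal U V f g"
    and inf: "infinite (UNIV :: 'a set)" and dom: "\<And>k. (f ^^ k) x \<in> U"
  shows "inj (\<lambda>k. (f ^^ k) x)"
proof (rule ccontr)
  assume "\<not> inj (\<lambda>k. (f ^^ k) x)"
  then obtain i j where ij: "i < j" "(f ^^ i) x = (f ^^ j) x"
    unfolding inj_on_def by (metis nat_neq_iff)
  define p where "p = j - i"
  have p: "p > 0" "(f ^^ p) x = x"
    using ij funpow_inverse[OF H dom, of i p] funpow_inverse[OF H dom, of i 0] by (auto simp: p_def)
  let ?S = "range (\<lambda>k. (f ^^ k) x)"
  have "?S \<subseteq> (\<lambda>k. (f ^^ k) x) ` {..<p}"
    using funpow_mod_eq[OF p(2)] p(1) by (metis (no_types, lifting) image_iff image_subsetI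
      lessThan_iff mod_less_divisor)
  then have fin: "finite ?S" using finite_subset by blast
  have "g ((f ^^ k) x) \<in> ?S" for k
  proof -
    \<comment> \<open>Going once around the period makes the exponent positive, so that \<open>g\<close> can lower it.\<close>
    have "(f ^^ k) x = (f ^^ (k + p)) x"
      using p(2) by (simp add: funpow_add)
    also have "\<dots> = f ((f ^^ (k + p - 1)) x)"
      using p(1) by (metis Suc_diff_1 add_gr_0 comp_apply funpow.simps(2))
    finally show ?thesis
      using homeomorphism_apply1[OF H dom] by auto
  qed
  moreover have "f ((f ^^ k) x) \<in> ?S" for k
    using rangeI[of "\<lambda>k. (f ^^ k) x" "Suc k"] by simp
  ultimately have "bi_invariant U V f g ?S"
    by (auto simp: bi_invariant_def)
  then show False
    using finite_bi_invariant_empty[OF min inf fin] by blast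
qed

text \<open>The points that the iterates accumulate at form a closed set, which is invariant in both
  directions because shifting a sequence does not change its accumulation points, and which is
  nonempty by compactness.\<close>

lemma dense_iterates_compact:
  fixes f g :: "'a::t2_space \<Rightarrow> 'a"
  assumes H: "homeomorphism U V f g" and "open U" "open V" and min: "bi_minimal U V f g"
    and comp: "compact (UNIV :: 'a set)" and dom: "\<And>k. (f ^^ k) x \<in> U"
  shows "closure (iterates U f x) = UNIV"
proof -
  define T where "T n = (\<lambda>k. (f ^^ k) x) ` {n..}" for n
  define L where "L = (\<Inter>n. closure (T n))"
  have T_anti: "T n \<subseteq> T m" if "m \<le> n" for m n
    using that by (auto simp: T_def)
  have "L \<noteq> {}"
  proof -
    have "UNIV \<inter> (\<Inter>n. closure (T n)) \<noteq> {}"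
    proof (rule compact_imp_fip_image[OF comp])
      fix I :: "nat set" assume "finite I"
      then have "T (Max (insert 0 I)) \<subseteq> T n" if "n \<in> I" for n
        using that by (intro T_anti) auto
      then have "(f ^^ Max (insert 0 I)) x \<in> closure (T n)" if "n \<in> I" for n
        using that closure_subset[of "T n"] by (force simp: T_def)
      then show "UNIV \<inter> (\<Inter>n\<in>I. closure (T n)) \<noteq> {}" by blast
    qed auto
    then show ?thesis by (simp add: L_def)
  qed
  moreover have "closed L" by (auto simp: L_def)
  moreover have "bi_invariant U V f g L"
    unfolding bi_invariant_def L_def
  proof (safe)
    fix z n assume z: "z \<in> (\<Inter>n. closure (T n))" "z \<in> U"
    have "f ` (T n \<inter> U) \<subseteq> T n"
      unfolding T_def
    proof safe
      fix k assume "n \<le> k"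
      then show "f ((f ^^ k) x) \<in> (\<lambda>k. (f ^^ k) x) ` {n..}"
        by (intro image_eqI[of _ _ "Suc k"]) auto
    qed
    moreover have "f z \<in> closure (f ` (T n \<inter> U))"
      using z \<open>open U\<close> H by (intro image_closure_open) (auto simp: homeomorphism_def)
    ultimately show "f z \<in> closure (T n)"
      using closure_mono by blast
  next
    fix z n assume z: "z \<in> (\<Inter>n. closure (T n))" "z \<in> V"
    \<comment> \<open>Stepping back needs the later tail, since \<open>g\<close> need not send \<open>f\<^sup>n(x)\<close> into the tail from \<open>n\<close>.\<close>
    have "g ` (T (Suc n) \<inter> V) \<subseteq> T n"
      unfolding T_def
    proof safe
      fix k assume "Suc n \<le> k"
      then obtain m where "k = Suc m" "n \<le> m" by (metis Suc_le_D Suc_le_mono)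
      then show "g ((f ^^ k) x) \<in> (\<lambda>k. (f ^^ k) x) ` {n..}"
        using homeomorphism_apply1[OF H dom[of m]] by auto
    qed
    moreover have "g z \<in> closure (g ` (T (Suc n) \<inter> V))"
      using z \<open>open V\<close> H by (intro image_closure_open) (auto simp: homeomorphism_def)
    ultimately show "g z \<in> closure (T n)"
      using closure_mono by blast
  qed
  ultimately have "L = UNIV"
    using min by (auto simp: bi_minimal_def)
  then have "closure (T 0) = UNIV" by (auto simp: L_def)
  then show ?thesis
    by (simp add: T_def iterates_total[OF dom] atLeast_0)
qed

section \<open>Cutting orbits along a closed set\<close>

text \<open>Removing \<open>Y\<close> from the domain \<open>U\<close> removes \<open>f(Y)\<close> from the range \<open>V\<close>.  Each \<open>y \<in> Y\<close> then becomes
  the upper end of its cut orbit and \<open>f(y)\<close> the lower end of its own; the condition asks that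
  from either end the cut map can be iterated forever, away from the cut.\<close>

definition cut_ends_free ::
    "'a set \<Rightarrow> 'a set \<Rightarrow> ('a \<Rightarrow> 'a) \<Rightarrow> ('a \<Rightarrow> 'a) \<Rightarrow> 'a set \<Rightarrow> bool" where
  "cut_ends_free U V f g Y \<longleftrightarrow>
     (\<forall>y\<in>Y. \<forall>k. (g ^^ k) y \<in> V - f ` Y) \<and> (\<forall>z\<in>f ` Y. \<forall>k. (f ^^ k) z \<in> U - Y)"

lemma image_image_homeomorphism:
  assumes "homeomorphism U V f g" "Y \<subseteq> U"
  shows "g ` f ` Y = Y"
proof -
  have "g (f y) = y" if "y \<in> Y" for y
    using homeomorphism_apply1[OF assms(1)] assms(2) that by blast
  then show ?thesis by (simp add: image_image)
qed

lemma cut_ends_free_iterates: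
  assumes "cut_ends_free U V f g Y" "Y \<subseteq> U" "y \<in> Y"
  shows "(g ^^ k) y \<in> V" "(f ^^ k) y \<in> U"
proof -
  show "(g ^^ k) y \<in> V" using assms by (auto simp: cut_ends_free_def)
  have "(f ^^ j) (f y) \<in> U" for j
    using assms by (auto simp: cut_ends_free_def)
  then show "(f ^^ k) y \<in> U"
    using assms(2,3) by (cases k) (auto simp: funpow_swap1)
qed

text \<open>One of the two halves of a cut orbit that starts at the cut is a single point, so the other half
  is infinite.\<close>

lemma infinite_cut_orbits_imp_cut_ends_free:
  assumes inf: "\<And>x. infinite (bi_orbit (U - Y) (V - f ` Y) f g x)"
  shows "cut_ends_free U V f g Y"
proof -
  have "infinite (iterates (V - f ` Y) g y)" if "y \<in> Y" for y
    using inf[of y] that by (simp add: bi_orbit_def iterates_outside)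
  moreover have "infinite (iterates (U - Y) f z)" if "z \<in> f ` Y" for z
    using inf[of z] that by (simp add: bi_orbit_def iterates_outside[of z "V - f ` Y" g])
  ultimately show ?thesis
    unfolding cut_ends_free_def by (intro conjI ballI allI infinite_iterates_total)
qed

text \<open>The steps that the cut removes are those from \<open>Y\<close> to \<open>f(Y)\<close> and back, so only these can lead
  out of a set that the cut map preserves.\<close>

lemma bi_invariant_cut_leave:
  assumes inv: "bi_invariant (U - Y) (V - f ` Y) f g Z" and "\<not> bi_invariant U V f g Z"
  obtains z where "z \<in> Z" "z \<in> Y" "f z \<notin> Z" | z where "z \<in> Z" "z \<in> f ` Y" "g z \<notin> Z"
proof -
  consider z where "z \<in> Z" "z \<in> U" "f z \<notin> Z" | z where "z \<in> Z" "z \<in> V" "g z \<notin> Z"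
    using assms(2) by (auto simp: bi_invariant_def)
  then show thesis
  proof cases
    case (1 z)
    then have "z \<in> Y"
      using inv by (auto simp: bi_invariant_def)
    then show thesis using that(1) 1 by simp
  next
    case (2 z)
    then have "z \<in> f ` Y"
      using inv unfolding bi_invariant_def by (metis DiffI IntI image_subset_iff)
    then show thesis using that(2) 2 by simp
  qed
qed

text \<open>By minimality of the full map, a finite cut orbit fails to be invariant, so it contains an end
  at the cut; the iterates from that end stay in the cut orbit and are pairwise distinct.\<close>

lemma cut_ends_free_imp_infinite_cut_orbits:
  fixes f g :: "'a::t1_space \<Rightarrow> 'a"
  assumes H: "homeomorphism U V f g" and min: "bi_minimal U V f g"
    and inf: "infinite (UNIV :: 'a set)" and Y: "Y \<subseteq> U" and ends: "cut_ends_free U V f g Y"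
  shows "infinite (bi_orbit (U - Y) (V - f ` Y) f g x)" (is "infinite ?F")
proof
  assume fin: "finite ?F"
  have inv: "bi_invariant (U - Y) (V - f ` Y) f g ?F"
    using bi_invariant_bi_orbit[OF homeomorphism_remove[OF H Y]] .
  have "\<not> bi_invariant U V f g ?F"
    using finite_bi_invariant_empty[OF min inf fin] bi_orbit_nonempty by metis
  have H': "homeomorphism V U g f" and min': "bi_minimal V U g f"
    using homeomorphism_symD[OF H] min bi_minimal_swap by blast+
  from bi_invariant_cut_leave[OF inv \<open>\<not> bi_invariant U V f g ?F\<close>] show False
  proof cases
    case (1 z)
    then have dom: "\<And>k. (g ^^ k) z \<in> V - f ` Y"
      using ends by (auto simp: cut_ends_free_def)
    have "range (\<lambda>k. (g ^^ k) z) \<subseteq> ?F"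
      using bi_invariant_iterates(2)[OF inv 1(1)] unfolding iterates_total[OF dom] .
    moreover have "infinite (range (\<lambda>k. (g ^^ k) z))"
      using dom by (intro range_inj_infinite inj_iterates[OF H' min' inf]) auto
    ultimately show False using fin finite_subset by blast
  next
    case (2 z)
    then have dom: "\<And>k. (f ^^ k) z \<in> U - Y"
      using ends by (auto simp: cut_ends_free_def)
    have "range (\<lambda>k. (f ^^ k) z) \<subseteq> ?F"
      using bi_invariant_iterates(1)[OF inv 2(1)] unfolding iterates_total[OF dom] .
    moreover have "infinite (range (\<lambda>k. (f ^^ k) z))"
      using dom by (intro range_inj_infinite inj_iterates[OF H min inf]) auto
    ultimately show False using fin finite_subset by blast
  qed
qed

text \<open>If a closed set \<open>C\<close> is invariant under the cut map only, then it contains an end at the cut.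
  Starting from an end \<open>y \<in> Y\<close>, the whole backward orbit of \<open>y\<close> lies in \<open>C\<close>.  Starting from an end
  \<open>f(y)\<close>, the set \<open>C\<close> contains the forward orbit of \<open>y\<close> except perhaps \<open>y\<close> itself; so \<open>C\<close> misses at most
  \<open>y\<close>, and the point before \<open>y\<close> forces \<open>y \<in> C\<close>.\<close>

lemma bi_minimal_cutI:
  fixes f g :: "'a::t1_space \<Rightarrow> 'a"
  assumes H: "homeomorphism U V f g" and min: "bi_minimal U V f g"
    and inf: "infinite (UNIV :: 'a set)" and Y: "Y \<subseteq> U" and ends: "cut_ends_free U V f g Y"
    and dense: "\<And>y. y \<in> Y \<Longrightarrow> closure (iterates U f y) = UNIV"
      "\<And>y. y \<in> Y \<Longrightarrow> closure (iterates V g y) = UNIV"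
  shows "bi_minimal (U - Y) (V - f ` Y) f g"
  unfolding bi_minimal_def
proof (intro allI impI, elim conjE)
  fix C assume C: "closed C" "bi_invariant (U - Y) (V - f ` Y) f g C"
  show "C = {} \<or> C = UNIV"
  proof (cases "bi_invariant U V f g C")
    case True
    then show ?thesis using min C by (auto simp: bi_minimal_def)
  next
    case False
    from bi_invariant_cut_leave[OF C(2) this] show ?thesis
    proof cases
      case (1 y)
      then have dom: "\<And>k. (g ^^ k) y \<in> V - f ` Y"
        using ends by (auto simp: cut_ends_free_def)
      have "iterates V g y = iterates (V - f ` Y) g y"
        using iterates_total[OF dom] iterates_total[of g y V] dom by simp
      also have "\<dots> \<subseteq> C"
        by (rule bi_invariant_iterates(2)[OF C(2) 1(1)])
      finally show ?thesis
        using dense(2)[OF 1(2)] closure_minimal[OF _ C(1)] by blast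
    next
      case (2 z)
      then obtain y where y: "y \<in> Y" "z = f y" "g z = y"
        using homeomorphism_apply1[OF H] Y by auto
      have dom: "\<And>k. (f ^^ k) z \<in> U - Y"
        using ends 2(2) by (auto simp: cut_ends_free_def)
      have "iterates U f y \<subseteq> insert y (iterates (U - Y) f z)"
      proof -
        have "(f ^^ k) y \<in> insert y (range (\<lambda>k. (f ^^ k) z))" for k
          by (cases k) (auto simp: y(2) funpow_swap1)
        then show ?thesis unfolding iterates_total[OF dom] by (auto simp: iterates_def)
      qed
      also have "\<dots> \<subseteq> insert y C"
        using bi_invariant_iterates(1)[OF C(2) 2(1)] by auto
      finally have "insert y C = UNIV"
        using dense(1)[OF y(1)] closure_minimal[OF _ closed_insert[OF C(1)]] by blast
      moreover have "g y \<noteq> y"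
      proof -
        have "inj (\<lambda>k. (g ^^ k) y)"
          using inj_iterates[OF homeomorphism_symD[OF H] min[unfolded bi_minimal_swap[of U]] inf]
            cut_ends_free_iterates(1)[OF ends Y y(1)] .
        from injD[OF this, of 1 0] show ?thesis by auto
      qed
      ultimately have "g y \<in> C" by blast
      \<comment> \<open>The cut map takes \<open>g y\<close> to \<open>y\<close>, so a closed set that it preserves cannot omit
        \<open>y\<close> alone.\<close>
      moreover have "y \<in> V - f ` Y"
        using ends y(1) unfolding cut_ends_free_def by (metis funpow_0)
      then have "g y \<in> U - Y" "f (g y) = y"
        using homeomorphism_apply2[OF H] homeomorphism_image2[OF homeomorphism_remove[OF H Y]]
        by auto
      ultimately have "y \<in> C"
        using C(2) unfolding bi_invariant_def by (metis IntI image_subset_iff)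
      then show ?thesis using 2(3) y(3) by simp
    qed
  qed
qed

lemma bi_orbit_subset_iterates:
  assumes "y \<notin> W" "W' \<subseteq> V"
  shows "bi_orbit W W' f g y \<subseteq> iterates V g y"
  using iterates_mono[OF assms(2)] self_in_iterates[of y V g]
  unfolding bi_orbit_def iterates_outside[OF assms(1)] by blast

lemma bi_minimal_cut_dense:
  assumes H: "homeomorphism U V f g" and "open (U - Y)" "open (V - f ` Y)" and Y: "Y \<subseteq> U"
    and min: "bi_minimal (U - Y) (V - f ` Y) f g" and y: "y \<in> Y"
  shows "closure (iterates V g y) = UNIV" "closure (iterates U f y) = UNIV"
proof -
  have orb: "closure (bi_orbit (U - Y) (V - f ` Y) f g x) = UNIV" for x
    using min[unfolded bi_minimal_iff_dense_orbits[OF homeomorphism_remove[OF H Y] assms(2,3)]] ..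
  have "bi_orbit (U - Y) (V - f ` Y) f g y \<subseteq> iterates V g y"
    using y by (intro bi_orbit_subset_iterates) auto
  from closure_mono[OF this] show "closure (iterates V g y) = UNIV"
    using orb[of y] by auto
  have "bi_orbit (U - Y) (V - f ` Y) f g (f y) \<subseteq> iterates U f (f y)"
    using y by (subst bi_orbit_swap, intro bi_orbit_subset_iterates) auto
  also have "\<dots> \<subseteq> iterates U f y"
    using y Y by (intro iterates_shift) auto
  finally have "bi_orbit (U - Y) (V - f ` Y) f g (f y) \<subseteq> iterates U f y" .
  from closure_mono[OF this] show "closure (iterates U f y) = UNIV"
    using orb[of "f y"] by auto
qed

lemma meets_orbits_at_most_onceD:
  assumes "meets_orbits_at_most_once U f Y" "y \<in> Y" "n \<noteq> 0" "y \<in> pa_D U f (- n)"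
    and "pa_power U f n y \<in> Y"
  shows "pa_power U f n y = y"
  using assms unfolding meets_orbits_at_most_once_def by blast

lemma cut_ends_free_iff:
  fixes f g :: "'a::t1_space \<Rightarrow> 'a"
  assumes H: "homeomorphism U V f g" and min: "bi_minimal U V f g"
    and inf: "infinite (UNIV :: 'a set)" and Y: "Y \<subseteq> U"
  shows "Y \<subseteq> pa_D_gl U f \<and> meets_orbits_at_most_once U f Y \<longleftrightarrow> cut_ends_free U V f g Y"
proof safe
  assume gl: "Y \<subseteq> pa_D_gl U f" and once: "meets_orbits_at_most_once U f Y"
  have H': "homeomorphism V U g f" and min': "bi_minimal V U g f"
    using homeomorphism_symD[OF H] min bi_minimal_swap by blast+
  have dom: "(f ^^ k) y \<in> U" "(g ^^ k) y \<in> V" if "y \<in> Y" for y k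
    using gl that by (auto simp: pa_D_gl_iff[OF H])
  \<comment> \<open>Meeting \<open>Y\<close> again is possible only at the same point, hence only for a periodic point.\<close>
  have fwd: "(f ^^ Suc k) y \<notin> Y" if "y \<in> Y" for y k
  proof
    assume "(f ^^ Suc k) y \<in> Y"
    moreover have "y \<in> pa_D U f (- int (Suc k))"
      unfolding pa_D_neg nat_iter_dom_iff using dom that by blast
    moreover have "pa_power U f (int (Suc k)) y = (f ^^ Suc k) y"
      unfolding pa_power_def nat_int by simp
    ultimately have "(f ^^ Suc k) y = (f ^^ 0) y"
      using meets_orbits_at_most_onceD[OF once that, of "int (Suc k)"]
      by (simp del: of_nat_Suc funpow.simps(2))
    then show False
      using injD[OF inj_iterates[OF H min inf dom(1)[OF that]], of "Suc k" 0] by simp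
  qed
  have bwd: "(g ^^ Suc k) y \<notin> Y" if "y \<in> Y" for y k
  proof
    assume "(g ^^ Suc k) y \<in> Y"
    moreover have *: "y \<in> nat_iter_dom V g (Suc k)"
      unfolding nat_iter_dom_iff using dom that by blast
    moreover have "y \<in> pa_D U f (- (- int (Suc k)))"
      unfolding minus_minus pa_D_pos[OF H] by fact
    moreover have "pa_power U f (- int (Suc k)) y = (g ^^ Suc k) y"
      using pa_power_neg[OF H *] .
    ultimately have "(g ^^ Suc k) y = (g ^^ 0) y"
      using meets_orbits_at_most_onceD[OF once that, of "- int (Suc k)"]
      by (simp del: of_nat_Suc funpow.simps(2))
    then show False
      using injD[OF inj_iterates[OF H' min' inf dom(2)[OF that]], of "Suc k" 0] by simp
  qed
  have "(g ^^ k) y \<notin> f ` Y" if "y \<in> Y" for y k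
  proof
    assume "(g ^^ k) y \<in> f ` Y"
    then have "(g ^^ Suc k) y \<in> g ` f ` Y" by auto
    then show False
      using bwd[OF that] image_image_homeomorphism[OF H Y] by simp
  qed
  moreover have "(f ^^ k) (f y) \<in> U - Y" if "y \<in> Y" for y k
    using fwd[OF that, of k] dom(1)[OF that, of "Suc k"] by (simp add: funpow_swap1)
  ultimately show "cut_ends_free U V f g Y"
    using dom by (auto simp: cut_ends_free_def)
next
  fix y assume "cut_ends_free U V f g Y" "y \<in> Y"
  then show "y \<in> pa_D_gl U f"
    using cut_ends_free_iterates[OF _ Y] by (auto simp: pa_D_gl_iff[OF H])
next
  assume ends: "cut_ends_free U V f g Y"
  have "pa_power U f n y \<notin> Y" if n: "n \<noteq> 0" and y: "y \<in> Y" for n y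
  proof (cases n rule: int_cases)
    case (nonneg m)
    then obtain k where k: "n = int (Suc k)" using n by (cases m) auto
    have "(f ^^ k) (f y) \<notin> Y" using ends y by (auto simp: cut_ends_free_def)
    then show ?thesis unfolding k pa_power_def nat_int by (simp add: funpow_swap1)
  next
    case k: (neg k)
    have v: "(g ^^ k) y \<in> V - f ` Y"
      using ends y by (auto simp: cut_ends_free_def)
    then have "(g ^^ Suc k) y \<notin> Y"
      using homeomorphism_apply2[OF H, of "(g ^^ k) y"] by (auto simp: image_iff)
    moreover have "y \<in> nat_iter_dom V g (Suc k)"
      using cut_ends_free_iterates(1)[OF ends Y y] by (auto simp: nat_iter_dom_iff)
    ultimately show ?thesis unfolding k using pa_power_neg[OF H] by metis
  qed
  then show "meets_orbits_at_most_once U f Y"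
    by (auto simp: meets_orbits_at_most_once_def)
qed

text \<open>All orbits are countable, and those of the full map are infinite because they are dense.\<close>

lemma preserves_orbit_size_iff:
  fixes f g :: "'a::t1_space \<Rightarrow> 'a"
  assumes H: "homeomorphism U V f g" and "open U" "open V" and min: "bi_minimal U V f g"
    and inf: "infinite (UNIV :: 'a set)" and Y: "Y \<subseteq> U"
  shows "preserves_orbit_size U f Y \<longleftrightarrow> (\<forall>x. infinite (bi_orbit (U - Y) (V - f ` Y) f g x))"
proof -
  have "infinite (bi_orbit U V f g x)" for x
    using min bi_minimal_iff_dense_orbits[OF H assms(2,3)] infinite_dense[OF inf] by blast
  moreover have "A \<approx> B \<longleftrightarrow> infinite A"
    if "countable A" "countable B" "infinite B" for A B :: "'a set"
  proof
    assume "infinite A"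
    have "C \<approx> (UNIV :: nat set)" if "countable C" "infinite C" for C :: "'a set"
      using countableE_infinite[OF that] by (auto simp: eqpoll_def)
    from eqpoll_trans[OF this eqpoll_sym[OF this]] that \<open>infinite A\<close> show "A \<approx> B"
      by simp
  qed (use that eqpoll_finite_iff in auto)
  ultimately show ?thesis
    unfolding preserves_orbit_size_def pa_orbit_eq[OF H] pa_orbit_eq[OF homeomorphism_remove[OF H Y]]
    by (simp add: countable_bi_orbit)
qed

section \<open>Invariant measures\<close>

lemma borel_preimage:
  assumes "homeomorphism U V f g" "open U" "B \<in> sets borel"
  shows "f -` B \<inter> U \<in> sets borel"
proof -
  have "f \<in> borel_measurable (restrict_space borel U)"
    using assms by (intro borel_measurable_continuous_on_restrict) (auto simp: homeomorphism_def)
  from measurable_sets[OF this assms(3)] show ?thesis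
    using assms(2) by (simp add: space_restrict_space sets_restrict_space_iff)
qed

lemma measure_preserving_swap:
  assumes H: "homeomorphism U V f g" and "open V"
    and inv: "\<And>B. B \<in> sets borel \<Longrightarrow> B \<subseteq> V \<Longrightarrow> emeasure \<mu> (f -` B \<inter> U) = emeasure \<mu> B"
    and A: "A \<in> sets borel" "A \<subseteq> U"
  shows "emeasure \<mu> (g -` A \<inter> V) = emeasure \<mu> A"
proof -
  have "f -` (g -` A \<inter> V) \<inter> U = A"
    using A(2) homeomorphism_apply1[OF H] homeomorphism_image1[OF H] by fastforce
  moreover have "g -` A \<inter> V \<in> sets borel"
    using borel_preimage[OF homeomorphism_symD[OF H] assms(2) A(1)] .
  ultimately show ?thesis using inv[of "g -` A \<inter> V"] by simp
qed

text \<open>The sets \<open>A n\<close> of points that reach \<open>Y\<close> after exactly \<open>n\<close> steps in \<open>W\<close> are disjoint, because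
  iteration stops in \<open>Y\<close>.  They all have the measure of \<open>Y\<close>, because the assumption on backward
  iterates keeps them inside the range \<open>W'\<close>, where invariance applies.  In a finite measure space
  that measure has to be zero.\<close>

lemma null_cut:
  assumes H: "homeomorphism W W' f g" and "open W"
    and prob: "prob_space \<mu>" and sets: "sets \<mu> = sets borel"
    and inv: "\<And>B. B \<in> sets borel \<Longrightarrow> B \<subseteq> W' \<Longrightarrow> emeasure \<mu> (f -` B \<inter> W) = emeasure \<mu> B"
    and Y: "Y \<in> sets borel" "Y \<inter> W = {}" and ends: "\<And>y k. y \<in> Y \<Longrightarrow> (g ^^ k) y \<in> W'"
  shows "emeasure \<mu> Y = 0"
proof -
  interpret prob_space \<mu> by fact
  define A where "A = rec_nat Y (\<lambda>_ B. f -` B \<inter> W)"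
  have A_simps: "A 0 = Y" "\<And>n. A (Suc n) = f -` A n \<inter> W" by (auto simp: A_def)
  have A_borel: "A n \<in> sets borel" for n
    by (induction n) (use Y borel_preimage[OF H \<open>open W\<close>] in \<open>auto simp: A_simps\<close>)
  have A_iter: "\<exists>y\<in>Y. x = (g ^^ n) y" if "x \<in> A n" for x n
    using that
  proof (induction n arbitrary: x)
    case (Suc n)
    then obtain y where "y \<in> Y" "f x = (g ^^ n) y" "x \<in> W" by (auto simp: A_simps)
    then show ?case using homeomorphism_apply1[OF H \<open>x \<in> W\<close>] by auto
  qed (auto simp: A_simps)
  have A_sub: "A n \<subseteq> W'" for n
    using A_iter ends by blast
  have measA: "measure \<mu> (A n) = measure \<mu> Y" for n
    by (induction n) (use inv[OF A_borel A_sub] in \<open>auto simp: A_simps measure_def\<close>)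
  have A_disj: "A m \<inter> A (m + Suc d) = {}" for m d
    by (induction m) (use Y(2) in \<open>auto simp: A_simps\<close>)
  have "disjoint_family A"
    unfolding disjoint_family_on_def
    by (metis A_disj Int_commute less_imp_Suc_add add_Suc_right nat_neq_iff)
  then have "(\<lambda>n. measure \<mu> (A n)) sums measure \<mu> (\<Union>n. A n)"
    using A_borel sets by (intro finite_measure_UNION) auto
  then have "summable (\<lambda>n::nat. measure \<mu> Y)"
    unfolding measA by (rule sums_summable)
  then have "measure \<mu> Y = 0"
    by (simp add: summable_const_iff)
  then show ?thesis by (simp add: emeasure_eq_measure)
qed

text \<open>On subsets of \<open>f(U - Y)\<close> the full map and the cut map have the same preimages.\<close>

lemma invariant_prob_measures_cut_subset:
  assumes H: "homeomorphism U V f g" and Y: "Y \<subseteq> U"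
  shows "invariant_prob_measures U f \<subseteq> invariant_prob_measures (U - Y) f"
proof -
  have "f -` B \<inter> (U - Y) = f -` B \<inter> U" if "B \<subseteq> f ` (U - Y)" for B
    using that homeomorphism_image1[OF homeomorphism_remove[OF H Y]] by auto
  moreover have "f ` (U - Y) \<subseteq> f ` U" by auto
  ultimately show ?thesis
    unfolding invariant_prob_measures_def by (smt (verit) Collect_mono order_trans)
qed

text \<open>A subset of \<open>V\<close> and its preimage change only by null sets when \<open>f(Y)\<close> and \<open>Y\<close> are removed
  from them.\<close>

lemma invariant_prob_measures_cut_eq:
  assumes H: "homeomorphism U V f g" and op: "open U" "open V" "open (U - Y)" "open (V - f ` Y)"
    and Y: "Y \<subseteq> U" "closed Y" and ends: "cut_ends_free U V f g Y"
  shows "invariant_prob_measures (U - Y) f = invariant_prob_measures U f"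
proof
  show "invariant_prob_measures U f \<subseteq> invariant_prob_measures (U - Y) f"
    by (rule invariant_prob_measures_cut_subset[OF H Y(1)])
  show "invariant_prob_measures (U - Y) f \<subseteq> invariant_prob_measures U f"
  proof
    fix \<mu> assume \<mu>: "\<mu> \<in> invariant_prob_measures (U - Y) f"
    note HW = homeomorphism_remove[OF H Y(1)]
    have prob: "prob_space \<mu>" and sets: "sets \<mu> = sets borel"
      using \<mu> by (auto simp: invariant_prob_measures_def regular_borel_measure_def)
    have inv: "emeasure \<mu> (f -` B \<inter> (U - Y)) = emeasure \<mu> B"
      if "B \<in> sets borel" "B \<subseteq> V - f ` Y" for B
      using \<mu> that homeomorphism_image1[OF HW] by (auto simp: invariant_prob_measures_def)
    have Y_borel: "Y \<in> sets borel" using Y(2) by simp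
    \<comment> \<open>The image of \<open>Y\<close> is only relatively closed in \<open>V\<close>, but it is a preimage under \<open>g\<close>.\<close>
    have "f ` Y = g -` Y \<inter> V"
      using Y(1) homeomorphism_image1[OF H] homeomorphism_apply1[OF H] homeomorphism_apply2[OF H]
      by (force simp: image_iff)
    then have fY_borel: "f ` Y \<in> sets borel"
      using borel_preimage[OF homeomorphism_symD[OF H] op(2) Y_borel] by simp
    have "emeasure \<mu> Y = 0"
      using ends by (intro null_cut[OF HW op(3) prob sets inv Y_borel])
        (auto simp: cut_ends_free_def)
    then have null_Y: "Y \<in> null_sets \<mu>" using Y_borel sets by auto
    have "emeasure \<mu> (f ` Y) = 0"
      using ends measure_preserving_swap[OF HW op(4) inv]
      by (intro null_cut[OF homeomorphism_symD[OF HW] op(4) prob sets _ fY_borel])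
        (auto simp: cut_ends_free_def)
    then have null_fY: "f ` Y \<in> null_sets \<mu>" using fY_borel sets by auto
    have "emeasure \<mu> (f -` B \<inter> U) = emeasure \<mu> B" if B: "B \<in> sets borel" "B \<subseteq> V" for B
    proof -
      have "emeasure \<mu> (f -` B \<inter> U) = emeasure \<mu> (f -` B \<inter> U - Y)"
        using emeasure_Diff_null_set[OF null_Y] borel_preimage[OF H op(1) B(1)] sets by simp
      also have "f -` B \<inter> U - Y = f -` (B - f ` Y) \<inter> (U - Y)"
        using homeomorphism_image1[OF HW] by auto
      also have "emeasure \<mu> \<dots> = emeasure \<mu> (B - f ` Y)"
        using B fY_borel by (intro inv) auto
      also have "\<dots> = emeasure \<mu> B"
        using emeasure_Diff_null_set[OF null_fY] B sets by simp
      finally show ?thesis .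
    qed
    then show "\<mu> \<in> invariant_prob_measures U f"
      using \<mu> homeomorphism_image1[OF H] by (auto simp: invariant_prob_measures_def)
  qed
qed

definition uniform_borel :: "'a::topological_space set \<Rightarrow> 'a measure" where
  "uniform_borel F = distr (measure_pmf (pmf_of_set F)) borel id"

lemma prob_space_uniform_borel: "prob_space (uniform_borel F)"
  unfolding uniform_borel_def by (rule measure_pmf.prob_space_distr) simp

lemma emeasure_uniform_borel:
  assumes "finite F" "F \<noteq> {}" "B \<in> sets borel"
  shows "emeasure (uniform_borel F) B = ennreal (card (F \<inter> B) / card F)"
  unfolding uniform_borel_def using assms
  by (subst emeasure_distr) (auto simp: emeasure_pmf_of_set)

text \<open>Only the points of \<open>F\<close> have mass, so a Borel set \<open>B\<close> may be enlarged to the open set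
  \<open>- (F - B)\<close> and shrunk to the compact set \<open>F \<inter> B\<close> without changing its measure.\<close>

lemma regular_uniform_borel:
  fixes F :: "'a::t2_space set"
  assumes F: "finite F" "F \<noteq> {}"
  shows "regular_borel_measure (uniform_borel F)"
  unfolding regular_borel_measure_def
proof (intro conjI ballI)
  show s: "sets (uniform_borel F) = sets borel" by (simp add: uniform_borel_def)
  fix B :: "'a set" assume B: "B \<in> sets borel"
  show "emeasure (uniform_borel F) B =
      (INF G \<in> {G. B \<subseteq> G \<and> open G}. emeasure (uniform_borel F) G)"
  proof (rule antisym)
    show "emeasure (uniform_borel F) B \<le>
        (INF G \<in> {G. B \<subseteq> G \<and> open G}. emeasure (uniform_borel F) G)"
      by (intro INF_greatest emeasure_mono) (auto simp: s)
    let ?G = "- (F - B)"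
    have G: "B \<subseteq> ?G" "open ?G" "F \<inter> ?G = F \<inter> B"
      using F finite_imp_closed[of "F - B"] by (auto simp only: open_Compl)
    then have "emeasure (uniform_borel F) ?G = emeasure (uniform_borel F) B"
      using B by (simp only: emeasure_uniform_borel[OF F] borel_open)
    then show "(INF G \<in> {G. B \<subseteq> G \<and> open G}. emeasure (uniform_borel F) G)
        \<le> emeasure (uniform_borel F) B"
      using G by (intro INF_lower2[of ?G]) auto
  qed
  show "emeasure (uniform_borel F) B =
      (SUP K \<in> {K. K \<subseteq> B \<and> compact K}. emeasure (uniform_borel F) K)"
  proof (rule antisym)
    show "(SUP K \<in> {K. K \<subseteq> B \<and> compact K}. emeasure (uniform_borel F) K)
        \<le> emeasure (uniform_borel F) B"
      using B by (intro SUP_least emeasure_mono) (auto simp: s)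
    have K: "F \<inter> B \<subseteq> B" "compact (F \<inter> B)" "F \<inter> (F \<inter> B) = F \<inter> B"
      using F by (auto intro: finite_imp_compact)
    then have "emeasure (uniform_borel F) (F \<inter> B) = emeasure (uniform_borel F) B"
      using B by (simp only: emeasure_uniform_borel[OF F] borel_compact)
    then show "emeasure (uniform_borel F) B
        \<le> (SUP K \<in> {K. K \<subseteq> B \<and> compact K}. emeasure (uniform_borel F) K)"
      using K by (intro SUP_upper2[of "F \<inter> B"]) auto
  qed
qed

text \<open>Invariance on singletons already says that \<open>v\<close> and \<open>g(v)\<close> lie in \<open>F\<close> together, as both have the
  same mass; conversely \<open>f\<close> restricts to bijections between the relevant parts of an invariant \<open>F\<close>.\<close>

lemma uniform_borel_invariant_iff:
  fixes f g :: "'a::t2_space \<Rightarrow> 'a"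
  assumes H: "homeomorphism U V f g" and "open U" and F: "finite F" "F \<noteq> {}"
  shows "uniform_borel F \<in> invariant_prob_measures U f \<longleftrightarrow> bi_invariant U V f g F"
proof -
  have cF: "card F > 0" using F by (simp add: card_gt_0_iff)
  have "uniform_borel F \<in> invariant_prob_measures U f \<longleftrightarrow>
      (\<forall>B\<in>sets borel. B \<subseteq> V \<longrightarrow> card (F \<inter> (f -` B \<inter> U)) = card (F \<inter> B))"
    using prob_space_uniform_borel[of F] regular_uniform_borel[OF F] cF
      borel_preimage[OF H \<open>open U\<close>] homeomorphism_image1[OF H]
    by (auto simp: invariant_prob_measures_def emeasure_uniform_borel[OF F])
  also have "\<dots> \<longleftrightarrow> bi_invariant U V f g F"
  proof
    assume *: "\<forall>B\<in>sets borel. B \<subseteq> V \<longrightarrow> card (F \<inter> (f -` B \<inter> U)) = card (F \<inter> B)"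
    have "g v \<in> F \<longleftrightarrow> v \<in> F" if "v \<in> V" for v
    proof -
      have "f -` {v} \<inter> U = {g v}"
        using that homeomorphism_apply1[OF H] homeomorphism_apply2[OF H] homeomorphism_image2[OF H]
        by auto
      then have "card (F \<inter> {g v}) = card (F \<inter> {v})"
        using *[rule_format, of "{v}"] that by simp
      then show ?thesis by (cases "g v \<in> F"; cases "v \<in> F") auto
    qed
    moreover have "f u \<in> V" "g (f u) = u" if "u \<in> U" for u
      using that homeomorphism_apply1[OF H] homeomorphism_image1[OF H] by auto
    ultimately show "bi_invariant U V f g F"
      by (auto simp: bi_invariant_def) (metis)
  next
    assume inv: "bi_invariant U V f g F"
    show "\<forall>B\<in>sets borel. B \<subseteq> V \<longrightarrow> card (F \<inter> (f -` B \<inter> U)) = card (F \<inter> B)"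
    proof (intro ballI impI)
      fix B assume "B \<subseteq> V"
      have fF: "f u \<in> F" if "u \<in> F" "u \<in> U" for u
        using inv that by (auto simp: bi_invariant_def)
      have gF: "g v \<in> F" "g v \<in> U" if "v \<in> F" "v \<in> V" for v
        using inv that homeomorphism_image2[OF H] by (auto simp: bi_invariant_def)
      have "bij_betw f (F \<inter> (f -` B \<inter> U)) (F \<inter> B)"
        using homeomorphism_apply1[OF H] homeomorphism_apply2[OF H] fF gF \<open>B \<subseteq> V\<close>
        by (intro bij_betw_byWitness[where f' = g]) auto
      then show "card (F \<inter> (f -` B \<inter> U)) = card (F \<inter> B)"
        by (rule bij_betw_same_card)
    qed
  qed
  finally show ?thesis .
qed

text \<open>The uniform measure on a finite cut orbit is invariant under the cut map; were it invariant
  under the full map, the orbit would be a finite invariant set.\<close>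

lemma invariant_prob_measures_imp_infinite_cut_orbits:
  fixes f g :: "'a::t2_space \<Rightarrow> 'a"
  assumes H: "homeomorphism U V f g" and op: "open U" "open (U - Y)"
    and min: "bi_minimal U V f g" and inf: "infinite (UNIV :: 'a set)" and Y: "Y \<subseteq> U"
    and eq: "invariant_prob_measures (U - Y) f = invariant_prob_measures U f"
  shows "infinite (bi_orbit (U - Y) (V - f ` Y) f g x)" (is "infinite ?F")
proof
  assume fin: "finite ?F"
  have ne: "?F \<noteq> {}" by (rule bi_orbit_nonempty)
  note HW = homeomorphism_remove[OF H Y]
  have "bi_invariant (U - Y) (V - f ` Y) f g ?F"
    by (rule bi_invariant_bi_orbit[OF HW])
  then have "bi_invariant U V f g ?F"
    using uniform_borel_invariant_iff[OF HW op(2) fin ne] uniform_borel_invariant_iff[OF H op(1) fin ne]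
      eq by blast
  then show False
    using finite_bi_invariant_empty[OF min inf fin] ne by blast
qed

section \<open>The equivalence\<close>

theorem proposition6p9:
  fixes \<theta> :: "'a::t2_space \<Rightarrow> 'a" and U V Y :: "'a set"
  assumes "infinite (UNIV :: 'a set)"
    and "locally compact (UNIV :: 'a set)"
    and "partial_automorphism U V \<theta>"
    and "pa_minimal U \<theta>"
    and "closed Y" and "Y \<subseteq> U"
  shows "(pa_minimal (U - Y) \<theta> \<longleftrightarrow> preserves_dense_orbits U \<theta> Y) \<and>
    (pa_minimal (U - Y) \<theta> \<longleftrightarrow>
      preserves_orbit_size U \<theta> Y \<and>
      (\<forall>y\<in>Y. closure (pa_forward_orbit U \<theta> y) = UNIV \<and>
             closure (pa_backward_orbit U \<theta> y) = UNIV)) \<and>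
    (compact (UNIV :: 'a set) \<longrightarrow>
      (pa_minimal (U - Y) \<theta> \<longleftrightarrow> preserves_orbit_size U \<theta> Y) \<and>
      (pa_minimal (U - Y) \<theta> \<longleftrightarrow>
        Y \<subseteq> pa_D_gl U \<theta> \<and> meets_orbits_at_most_once U \<theta> Y) \<and>
      (pa_minimal (U - Y) \<theta> \<longleftrightarrow>
        invariant_prob_measures (U - Y) \<theta> = invariant_prob_measures U \<theta>))"
proof -
  note inf = assms(1) and Y = \<open>Y \<subseteq> U\<close>
  define g where "g = inv_into U \<theta>"
  have op: "open U" "open V" and H: "homeomorphism U V \<theta> g"
    using assms(3) by (auto simp: partial_automorphism_def g_def)
  note HW = homeomorphism_remove[OF H Y]
  have opW: "open (U - Y)" using op(1) \<open>closed Y\<close> by (rule open_Diff)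
  have "V - \<theta> ` Y = g -` (U - Y) \<inter> V"
    using homeomorphism_image2[OF HW] homeomorphism_image2[OF H] homeomorphism_apply2[OF H] Y
      homeomorphism_apply1[OF H]
    by auto
  then have opW': "open (V - \<theta> ` Y)"
    using continuous_on_open_vimage[OF op(2), of g] homeomorphism_cont2[OF H] opW by auto
  have min: "bi_minimal U V \<theta> g"
    using assms(4) by (simp add: pa_minimal_iff[OF H])
  let ?min = "bi_minimal (U - Y) (V - \<theta> ` Y) \<theta> g"
  let ?inf = "\<forall>x. infinite (bi_orbit (U - Y) (V - \<theta> ` Y) \<theta> g x)"
  let ?ends = "cut_ends_free U V \<theta> g Y"
  let ?dense = "\<forall>y\<in>Y. closure (iterates U \<theta> y) = UNIV \<and> closure (iterates V g y) = UNIV"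
  let ?meas = "invariant_prob_measures (U - Y) \<theta> = invariant_prob_measures U \<theta>"
  have min_iff: "?min \<longleftrightarrow> (\<forall>x. closure (bi_orbit (U - Y) (V - \<theta> ` Y) \<theta> g x) = UNIV)"
    by (rule bi_minimal_iff_dense_orbits[OF HW opW opW'])
  have "preserves_dense_orbits U \<theta> Y \<longleftrightarrow> ?min"
    using min bi_minimal_iff_dense_orbits[OF H op] min_iff
    by (simp add: preserves_dense_orbits_def pa_orbit_eq[OF H] pa_orbit_eq[OF HW])
  moreover have size_iff: "preserves_orbit_size U \<theta> Y \<longleftrightarrow> ?inf"
    by (rule preserves_orbit_size_iff[OF H op min inf Y])
  moreover have inf_ends: "?inf \<longleftrightarrow> ?ends"
    using infinite_cut_orbits_imp_cut_ends_free[of U Y V \<theta> g]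
      cut_ends_free_imp_infinite_cut_orbits[OF H min inf Y] by blast
  moreover have min_inf: "?inf" if "?min"
    using that min_iff infinite_dense[OF inf] by blast
  moreover have min_dense: "?dense" if "?min"
    using bi_minimal_cut_dense[OF H opW opW' Y that] by blast
  moreover have dense_min: "?min" if "?ends" "?dense"
    using bi_minimal_cutI[OF H min inf Y that(1)] that(2) by blast
  moreover have "?dense" if "compact (UNIV :: 'a set)" "?ends"
    using dense_iterates_compact[OF H op min that(1)]
      dense_iterates_compact[OF homeomorphism_symD[OF H] op(2,1) _ that(1)] min
      cut_ends_free_iterates[OF that(2) Y] by (simp add: bi_minimal_swap)
  moreover have "?meas \<longleftrightarrow> ?ends"
    using invariant_prob_measures_cut_eq[OF H op opW opW' Y \<open>closed Y\<close>] inf_ends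
      invariant_prob_measures_imp_infinite_cut_orbits[OF H op(1) opW min inf Y] by blast
  moreover note cut_ends_free_iff[OF H min inf Y]
  ultimately show ?thesis
    unfolding pa_minimal_iff[OF HW] pa_forward_orbit_eq pa_backward_orbit_eq[OF H]
    by blast
qed

end
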